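(* Let $d$ be an even positive integer and let $f$ be a form of degree $d$ in $n$ variables with real coefficients. Then the $d$-th root $f^{1/d}$ is a norm on $\mathbb{R}^n$ if and only if $f$ is convex and positive definite.
   Context: A form is a homogeneous polynomial. It is positive definite if $f(x)>0$ for all $x\ne0$. The statement "$f^{1/d}$ is a norm" includes that $f$ is nonnegative, so that the real $d$-th root is well defined. *)

theory Defs
  imports "HOL-Analysis.Analysis" "HOL-Library.Poly_Mapping"
begin

text \<open>
  A real polynomial in variables indexed by the finite type \<open>'n\<close> is a finitely supported map
  from exponent vectors to coefficients. The ring operations on this type supplied by
  \<open>Poly_Mapping\<close> are the usual polynomial ones (multiplication is convolution).
\<close>

type_synonym 'n real_mpoly = "('n \<Rightarrow>\<^sub>0 nat) \<Rightarrow>\<^sub>0 real"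

definition mpoly_eval :: "('n::finite) real_mpoly \<Rightarrow> real ^ 'n \<Rightarrow> real" where
  "mpoly_eval p x =
     (\<Sum>m\<in>Poly_Mapping.keys p. Poly_Mapping.lookup p m * (\<Prod>i\<in>UNIV. (x $ i) ^ Poly_Mapping.lookup m i))"

text \<open>The zero polynomial counts as a form of every degree.\<close>

definition is_form :: "nat \<Rightarrow> ('n::finite) real_mpoly \<Rightarrow> bool" where
  "is_form d p \<longleftrightarrow>
     (\<forall>m\<in>Poly_Mapping.keys p. (\<Sum>i\<in>UNIV. Poly_Mapping.lookup m i) = d)"

definition positive_definite :: "('a::zero \<Rightarrow> real) \<Rightarrow> bool" where
  "positive_definite f \<longleftrightarrow> (\<forall>x. x \<noteq> 0 \<longrightarrow> f x > 0)"

definition is_norm :: "('a::real_vector \<Rightarrow> real) \<Rightarrow> bool" where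
  "is_norm N \<longleftrightarrow>
     (\<forall>x. 0 \<le> N x) \<and>
     (\<forall>x. N x = 0 \<longleftrightarrow> x = 0) \<and>
     (\<forall>c x. N (c *\<^sub>R x) = \<bar>c\<bar> * N x) \<and>
     (\<forall>x y. N (x + y) \<le> N x + N y)"

end

theory Submission
  imports Defs
begin

text \<open>
  All that matters about a form \<open>f\<close> of even degree \<open>d\<close> is that it scales as
  \<open>f (c x) = c ^ d * f x\<close>; in particular it vanishes at the origin. Absolute homogeneity of the
  \<open>d\<close>-th root \<open>N\<close> and the equivalence of definiteness of \<open>N\<close> and of \<open>f\<close> follow at once, so what is left
  is to relate convexity of \<open>f\<close> to the triangle inequality for \<open>N\<close>.

  If \<open>N\<close> satisfies the triangle inequality, it is convex, and \<open>f = N ^ d\<close> is the composition of a convex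
  nonnegative function with the power map, which is convex, and monotone on the nonnegative reals.

  Conversely, if \<open>f\<close> is convex, then so is its sublevel set \<open>f \<le> 1\<close>, which is the unit ball of \<open>N\<close>. The
  normalised vectors \<open>x / N x\<close> and \<open>y / N y\<close> lie in it, and \<open>(x + y) / (N x + N y)\<close> is a convex
  combination of them. Hence it lies in the ball too, and this is the triangle inequality
  after rescaling.
\<close>

lemma form_eval_scaleR:
  assumes "is_form d p"
  shows "mpoly_eval p (c *\<^sub>R x) = c ^ d * mpoly_eval p x"
proof -
  have "(\<Prod>i\<in>UNIV. ((c *\<^sub>R x) $ i) ^ Poly_Mapping.lookup m i)
      = c ^ d * (\<Prod>i\<in>UNIV. (x $ i) ^ Poly_Mapping.lookup m i)"
    if "m \<in> Poly_Mapping.keys p" for m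
  proof -
    have "(\<Sum>i\<in>UNIV. Poly_Mapping.lookup m i) = d"
      using assms that by (simp add: is_form_def)
    then show ?thesis
      by (simp add: power_mult_distrib prod.distrib flip: power_sum)
  qed
  then show ?thesis
    unfolding mpoly_eval_def sum_distrib_left
    by (intro sum.cong) (simp_all add: algebra_simps)
qed

lemma is_norm_convex:
  assumes "is_norm N"
  shows "convex_on UNIV N"
proof (rule convex_onI)
  fix t :: real and x y
  assume t: "0 < t" "t < 1"
  have hom: "N (c *\<^sub>R z) = \<bar>c\<bar> * N z" for c z
    using assms unfolding is_norm_def by blast
  have "N ((1 - t) *\<^sub>R x + t *\<^sub>R y) \<le> N ((1 - t) *\<^sub>R x) + N (t *\<^sub>R y)"
    using assms unfolding is_norm_def by blast
  also have "\<dots> = (1 - t) * N x + t * N y"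
    using t by (simp add: hom)
  finally show "N ((1 - t) *\<^sub>R x + t *\<^sub>R y) \<le> (1 - t) * N x + t * N y" .
qed simp

text \<open>
  A convex function of a convex function is convex as long as the outer one is increasing on the
  values of the inner one; for the power map, nonnegativity of \<open>g\<close> provides this.
\<close>

lemma convex_on_power_nonneg:
  fixes g :: "'a::real_vector \<Rightarrow> real"
  assumes g: "convex_on S g" and nonneg: "\<And>x. x \<in> S \<Longrightarrow> 0 \<le> g x" and "even d"
  shows "convex_on S (\<lambda>x. g x ^ d)"
proof (rule convex_onI)
  fix t :: real and x y
  assume t: "0 < t" "t < 1" and xy: "x \<in> S" "y \<in> S"
  have S: "(1 - t) *\<^sub>R x + t *\<^sub>R y \<in> S"
    using convexD[OF convex_on_imp_convex[OF g] xy] t by simp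
  have "g ((1 - t) *\<^sub>R x + t *\<^sub>R y) \<le> (1 - t) * g x + t * g y"
    using convex_onD[OF g] t xy by simp
  then have "g ((1 - t) *\<^sub>R x + t *\<^sub>R y) ^ d \<le> ((1 - t) * g x + t * g y) ^ d"
    using nonneg[OF S] by (rule power_mono)
  also have "\<dots> \<le> (1 - t) * g x ^ d + t * g y ^ d"
    using convex_onD[OF convex_power_even[OF \<open>even d\<close>], of t "g x" "g y"] t by simp
  finally show "g ((1 - t) *\<^sub>R x + t *\<^sub>R y) ^ d \<le> (1 - t) * g x ^ d + t * g y ^ d" .
qed (rule convex_on_imp_convex[OF g])

text \<open>
  Rescaling \<open>x\<close> and \<open>y\<close> to points with \<open>F = 1\<close> makes a multiple of \<open>x + y\<close> a convex combination of
  them. Convexity bounds \<open>F\<close> by \<open>1\<close> there, and homogeneity turns this into the triangle inequality.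
\<close>

lemma root_triangle_if_convex_homogeneous:
  fixes F :: "'a::real_vector \<Rightarrow> real"
  assumes "d > 0"
    and hom: "\<And>c x. F (c *\<^sub>R x) = c ^ d * F x"
    and pos: "\<And>x. x \<noteq> 0 \<Longrightarrow> F x > 0"
    and conv: "convex_on UNIV F"
  shows "root d (F (x + y)) \<le> root d (F x) + root d (F y)"
proof -
  have F0: "F 0 = 0"
    using hom[of 0 0] \<open>d > 0\<close> by (simp add: zero_power)
  show ?thesis
  proof (cases "x = 0 \<or> y = 0")
    case True
    then show ?thesis by (auto simp: F0)
  next
    case False
    define a where "a = root d (F x)"
    define b where "b = root d (F y)"
    have ab: "a > 0" "b > 0" "a ^ d = F x" "b ^ d = F y"
      using False pos[of x] pos[of y] \<open>d > 0\<close> by (auto simp: a_def b_def real_root_pow_pos2)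
    \<comment> \<open>The weights \<open>1 - t = a / (a + b)\<close> and \<open>t = b / (a + b)\<close> cancel the two normalisations.\<close>
    define t where "t = b / (a + b)"
    have t: "0 \<le> t" "t \<le> 1" "1 - t = a / (a + b)"
      using ab by (auto simp: t_def field_simps)
    have unit: "F ((1 / a) *\<^sub>R x) = 1" "F ((1 / b) *\<^sub>R y) = 1"
      using ab False pos[of x] pos[of y] by (auto simp: hom power_divide)
    have "(1 / (a + b)) *\<^sub>R (x + y) = (1 - t) *\<^sub>R ((1 / a) *\<^sub>R x) + t *\<^sub>R ((1 / b) *\<^sub>R y)"
      using ab by (simp add: t(3) scaleR_add_right) (simp add: t_def)
    then have "F ((1 / (a + b)) *\<^sub>R (x + y)) \<le> (1 - t) * 1 + t * 1"
      using convex_onD[OF conv t(1,2), of "(1 / a) *\<^sub>R x" "(1 / b) *\<^sub>R y"]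
      by (simp only: unit UNIV_I)
    then have "F (x + y) \<le> (a + b) ^ d"
      using ab by (simp add: hom power_divide divide_simps)
    then have "root d (F (x + y)) \<le> root d ((a + b) ^ d)"
      using \<open>d > 0\<close> by simp
    then show ?thesis
      using ab \<open>d > 0\<close> by (simp add: real_root_power_cancel flip: a_def b_def)
  qed
qed

theorem theorem6p2p1:
  fixes d :: nat and f :: "('n::finite) real_mpoly"
  assumes "even d" and "d > 0" and "is_form d f"
  shows "((\<forall>x. 0 \<le> mpoly_eval f x) \<and> is_norm (\<lambda>x. root d (mpoly_eval f x)))
    \<longleftrightarrow> (convex_on UNIV (mpoly_eval f) \<and> positive_definite (mpoly_eval f))"
proof -
  define F where "F = mpoly_eval f"
  have hom: "F (c *\<^sub>R x) = c ^ d * F x" for c x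
    using form_eval_scaleR[OF \<open>is_form d f\<close>] by (simp add: F_def)
  have F0: "F 0 = 0"
    using hom[of 0 0] \<open>d > 0\<close> by (simp add: zero_power)
  have "(\<forall>x. 0 \<le> F x) \<and> is_norm (\<lambda>x. root d (F x)) \<longleftrightarrow> convex_on UNIV F \<and> positive_definite F"
  proof (intro iffI; elim conjE)
    assume nonneg: "\<forall>x. 0 \<le> F x" and norm: "is_norm (\<lambda>x. root d (F x))"
    have "convex_on UNIV (\<lambda>x. root d (F x) ^ d)"
      using is_norm_convex[OF norm] nonneg \<open>even d\<close> by (intro convex_on_power_nonneg)
        (auto simp: real_root_ge_zero)
    then have "convex_on UNIV F"
      using nonneg \<open>d > 0\<close> by (simp add: real_root_pow_pos2)
    moreover have "F x > 0" if "x \<noteq> 0" for x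
    proof -
      have "root d (F x) \<noteq> 0"
        using norm that by (simp add: is_norm_def)
      then have "F x \<noteq> 0"
        by auto
      then show ?thesis
        using nonneg[rule_format, of x] by linarith
    qed
    ultimately show "convex_on UNIV F \<and> positive_definite F"
      by (simp add: positive_definite_def)
  next
    assume conv: "convex_on UNIV F" and "positive_definite F"
    then have pos: "F x > 0" if "x \<noteq> 0" for x
      using that by (simp add: positive_definite_def)
    have nonneg: "0 \<le> F x" for x
      using pos[of x] F0 by (cases "x = 0") auto
    have "root d (F x) = 0 \<longleftrightarrow> x = 0" for x
      using pos[of x] F0 \<open>d > 0\<close> by (cases "x = 0") auto
    moreover have "root d (F (c *\<^sub>R x)) = \<bar>c\<bar> * root d (F x)" for c x
    proof -
      \<comment> \<open>Evenness of the degree is what produces the absolute value.\<close>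
      have "c ^ d = \<bar>c\<bar> ^ d"
        using \<open>even d\<close> by (simp add: power_even_abs)
      then show ?thesis
        using \<open>d > 0\<close> by (simp only: hom real_root_mult real_root_power_cancel abs_ge_zero)
    qed
    moreover have "root d (F (x + y)) \<le> root d (F x) + root d (F y)" for x y
      using \<open>d > 0\<close> hom pos conv by (rule root_triangle_if_convex_homogeneous)
    ultimately show "(\<forall>x. 0 \<le> F x) \<and> is_norm (\<lambda>x. root d (F x))"
      using nonneg \<open>d > 0\<close> by (simp add: is_norm_def)
  qed
  then show ?thesis
    by (simp only: F_def)
qed

end
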